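(* Let $\mathbf P=(P,\leq)$ be a poset, $a,b\in P$ with $a\leq b$, $x\in[a,b]$, and let $y$ be a complement of $x$. Assume that $e$ is the greatest element of $L\big(U(a,y),b\big)$ and $f$ is the smallest element of $U\big(a,L(y,b)\big)$. Then $a\leq f\leq e\leq b$, and the following are equivalent: (i) $e,f\in R(a,b,x)$; (ii) $(a,y,x)$ and $(x,y,b)$ are modular triples of $\mathbf P$.
   Context: In a poset $(P,\leq)$, for $A\subseteq P$ let $L(A)=\{p\in P\mid p\leq a\text{ for all }a\in A\}$ and $U(A)=\{p\in P\mid a\leq p\text{ for all }a\in A\}$. One writes $L(a)$ for $L(\{a\})$, $L(a,b)$ for $L(\{a,b\})$, $L(A,a)$ for $L(A\cup\{a\})$, $LU(A)$ for $L(U(A))$, and similarly for $U$. An element $y$ is a complement of $x$ if $LU(x,y)=UL(x,y)=P$. For $a\leq b$ and $x\in[a,b]$, an element $z\in[a,b]$ is a relative complement of $x$ in $[a,b]$ if $U(x,z)=U(b)$ and $L(x,z)=L(a)$; $R(a,b,x)$ denotes the set of all such relative complements. A triple $(p,q,r)$ of elements of $P$ is a modular triple of $\mathbf P$ if $p\leq r$ and $L\big(U(p,q),r\big)=LU\big(p,L(q,r)\big)$. *)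

theory Defs
  imports "HOL-Algebra.Order"
begin

(* Lower P A and Upper P A from HOL-Algebra are the sets L(A) and U(A).  Both are taken
   inside carrier P, and Lower P {} = Upper P {} = carrier P. *)

definition is_complement :: "('a, 'c) gorder_scheme \<Rightarrow> 'a \<Rightarrow> 'a \<Rightarrow> bool" where
  "is_complement P x y \<longleftrightarrow>
     x \<in> carrier P \<and> y \<in> carrier P \<and>
     Lower P (Upper P {x, y}) = carrier P \<and>
     Upper P (Lower P {x, y}) = carrier P"

(* Intended for a \<sqsubseteq> b and x in the interval from a to b. *)
definition rel_complements :: "('a, 'c) gorder_scheme \<Rightarrow> 'a \<Rightarrow> 'a \<Rightarrow> 'a \<Rightarrow> 'a set" where
  "rel_complements P a b x =
     {z \<in> \<lbrace>a..b\<rbrace>\<^bsub>P\<^esub>. Upper P {x, z} = Upper P {b} \<and> Lower P {x, z} = Lower P {a}}"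

definition modular_triple :: "('a, 'c) gorder_scheme \<Rightarrow> 'a \<Rightarrow> 'a \<Rightarrow> 'a \<Rightarrow> bool" where
  "modular_triple P p q r \<longleftrightarrow>
     p \<in> carrier P \<and> q \<in> carrier P \<and> r \<in> carrier P \<and>
     p \<sqsubseteq>\<^bsub>P\<^esub> r \<and>
     Lower P (Upper P {p, q} \<union> {r}) = Lower P (Upper P ({p} \<union> Lower P {q, r}))"

end

theory Submission
  imports Defs
begin

text \<open>Since \<open>y\<close> is a complement of \<open>x\<close>, both \<open>LU(x,y)\<close> and \<open>UL(x,y)\<close> are the whole poset, so
  \<open>LU(a,L(y,x)) = L(a)\<close> and \<open>L(U(x,y),b) = L(b)\<close>. On the other hand \<open>L(U(a,y),x) = L(x,e)\<close> and
  \<open>U(x,L(y,b)) = U(x,f)\<close>. Thus the two modularity conditions say \<open>L(x,e) = L(a)\<close> and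
  \<open>U(x,f) = U(b)\<close>, and the remaining two equations follow from \<open>a \<le> f \<le> e \<le> b\<close>.\<close>

context partial_order
begin

lemma Upper_Lower_Upper:
  assumes "A \<subseteq> carrier L"
  shows "Upper L (Lower L (Upper L A)) = Upper L A"
proof
  have "A \<subseteq> Lower L (Upper L A)"
    using assms by (intro Lower_memI subsetI) auto
  then show "Upper L (Lower L (Upper L A)) \<subseteq> Upper L A"
    by (rule Upper_antimono)
  show "Upper L A \<subseteq> Upper L (Lower L (Upper L A))"
    by (intro Upper_memI subsetI) (auto dest: subsetD[OF Upper_closed])
qed

lemma Lower_Upper_singleton:
  assumes "c \<in> carrier L"
  shows "Lower L (Upper L {c}) = Lower L {c}"
  using assms by (auto simp: Lower_def Upper_def intro: le_trans)

text \<open>The set L(U(a,y),b) is a lower set with greatest element e, hence equals L(e). Since x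
  \<sqsubseteq> b, intersecting it with L(x) replaces the bound b by x, which computes the left side
  of the modularity equation.\<close>

lemma modular_triple_complement_below:
  assumes carr: "a \<in> carrier L" "b \<in> carrier L" "x \<in> carrier L" "y \<in> carrier L"
    and ax: "a \<sqsubseteq> x" and xb: "x \<sqsubseteq> b"
    and UL: "Upper L (Lower L {x, y}) = carrier L"
    and e: "greatest L e (Lower L (Upper L {a, y} \<union> {b}))"
  shows "modular_triple L a y x \<longleftrightarrow> Lower L {x, e} = Lower L {a}"
proof -
  have e_carr: "e \<in> carrier L" and e_mem: "e \<in> Lower L (Upper L {a, y} \<union> {b})"
    and e_max: "\<And>z. z \<in> Lower L (Upper L {a, y} \<union> {b}) \<Longrightarrow> z \<sqsubseteq> e"
    by (fact greatest_closed[OF e] greatest_mem[OF e] greatest_le[OF e])+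
  have "Lower L (Upper L {a, y} \<union> {x}) = Lower L {x, e}"
  proof (intro equalityI subsetI)
    fix z assume z: "z \<in> Lower L (Upper L {a, y} \<union> {x})"
    then have "z \<in> Lower L (Upper L {a, y} \<union> {b})"
      using carr xb by (auto simp: Lower_def intro: le_trans)
    with z show "z \<in> Lower L {x, e}"
      using carr e_max by (auto simp: Lower_def)
  next
    fix z assume "z \<in> Lower L {x, e}"
    then show "z \<in> Lower L (Upper L {a, y} \<union> {x})"
      using carr e_carr e_mem by (auto simp: Lower_def intro: le_trans)
  qed
  \<comment> \<open>By \<open>UL\<close> every element of the carrier lies above all common lower
    bounds of x and y, so these put no condition on an upper bound of a.\<close>
  moreover have "Upper L ({a} \<union> Lower L {y, x}) = Upper L {a}"
    using UL carr by (auto simp: Upper_def insert_commute)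
  ultimately show ?thesis
    using carr ax by (simp add: modular_triple_def Lower_Upper_singleton)
qed

text \<open>The order dual of the argument for \<open>modular_triple_complement_below\<close>, with
  one extra step: \<open>modular_triple\<close> equates lower cones, whereas f describes an upper
  cone.\<close>

lemma modular_triple_complement_above:
  assumes carr: "a \<in> carrier L" "b \<in> carrier L" "x \<in> carrier L" "y \<in> carrier L"
    and ax: "a \<sqsubseteq> x" and xb: "x \<sqsubseteq> b"
    and LU: "Lower L (Upper L {x, y}) = carrier L"
    and f: "least L f (Upper L ({a} \<union> Lower L {y, b}))"
  shows "modular_triple L x y b \<longleftrightarrow> Upper L {x, f} = Upper L {b}"
proof -
  have f_carr: "f \<in> carrier L" and f_mem: "f \<in> Upper L ({a} \<union> Lower L {y, b})"
    and f_min: "\<And>z. z \<in> Upper L ({a} \<union> Lower L {y, b}) \<Longrightarrow> f \<sqsubseteq> z"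
    by (fact least_closed[OF f] least_mem[OF f] least_le[OF f])+
  have "Upper L ({x} \<union> Lower L {y, b}) = Upper L {x, f}"
  proof (intro equalityI subsetI)
    fix z assume z: "z \<in> Upper L ({x} \<union> Lower L {y, b})"
    then have "z \<in> Upper L ({a} \<union> Lower L {y, b})"
      using carr ax by (auto simp: Upper_def intro: le_trans)
    with z show "z \<in> Upper L {x, f}"
      using carr f_min by (auto simp: Upper_def)
  next
    fix z assume "z \<in> Upper L {x, f}"
    then show "z \<in> Upper L ({x} \<union> Lower L {y, b})"
      using carr f_carr f_mem by (auto simp: Upper_def intro: le_trans)
  qed
  moreover have "Lower L (Upper L {x, y} \<union> {b}) = Lower L {b}"
    using LU carr by (auto simp: Lower_def)
  ultimately have "modular_triple L x y b \<longleftrightarrow> Lower L (Upper L {b}) = Lower L (Upper L {x, f})"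
    using carr xb by (simp add: modular_triple_def Lower_Upper_singleton)
  \<comment> \<open>\<open>Lower L\<close> is injective on upper cones: applying
    \<open>Upper L\<close> to both sides gives the cones back by
    \<open>Upper_Lower_Upper\<close>.\<close>
  also have "\<dots> \<longleftrightarrow> Upper L {x, f} = Upper L {b}"
    using carr f_carr by (metis Upper_Lower_Upper empty_subsetI insert_subset)
  finally show ?thesis .
qed

end

theorem theorem5:
  fixes P :: "('a, 'c) gorder_scheme" (structure)
    and a b x y e f :: 'a
  assumes "partial_order P"
    and "a \<in> carrier P" and "b \<in> carrier P" and "a \<sqsubseteq> b"
    and "x \<in> \<lbrace>a..b\<rbrace>"
    and "is_complement P x y"
    and "greatest P e (Lower P (Upper P {a, y} \<union> {b}))"
    and "least P f (Upper P ({a} \<union> Lower P {y, b}))"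
  shows "(a \<sqsubseteq> f \<and> f \<sqsubseteq> e \<and> e \<sqsubseteq> b) \<and>
    ((e \<in> rel_complements P a b x \<and> f \<in> rel_complements P a b x) \<longleftrightarrow>
     (modular_triple P a y x \<and> modular_triple P x y b))"
proof -
  interpret partial_order P by fact
  have x: "x \<in> carrier P" "a \<sqsubseteq> x" "x \<sqsubseteq> b"
    using assms(5) by (auto simp: at_least_at_most_def)
  have y: "y \<in> carrier P" and LU: "Lower P (Upper P {x, y}) = carrier P"
    and UL: "Upper P (Lower P {x, y}) = carrier P"
    using assms(6) by (auto simp: is_complement_def)
  have e: "e \<in> carrier P" "e \<in> Lower P (Upper P {a, y} \<union> {b})"
    by (fact greatest_closed[OF assms(7)] greatest_mem[OF assms(7)])+
  have f: "f \<in> carrier P" "f \<in> Upper P ({a} \<union> Lower P {y, b})"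
    and f_min: "\<And>z. z \<in> Upper P ({a} \<union> Lower P {y, b}) \<Longrightarrow> f \<sqsubseteq> z"
    by (fact least_closed[OF assms(8)] least_mem[OF assms(8)] least_le[OF assms(8)])+
  \<comment> \<open>Both a and every common lower bound of y and b lie below b and below each upper
    bound of a and y. So e bounds all of them from above, and f is the least such bound.\<close>
  have "{a} \<union> Lower P {y, b} \<subseteq> Lower P (Upper P {a, y} \<union> {b})"
    using assms(2-4) y by (auto simp: Lower_def Upper_def intro: le_trans)
  then have "e \<in> Upper P ({a} \<union> Lower P {y, b})"
    using greatest_le[OF assms(7)] e(1) by (intro Upper_memI) auto
  then have fe: "f \<sqsubseteq> e" by (rule f_min)
  have af: "a \<sqsubseteq> f" and eb: "e \<sqsubseteq> b"
    using f e assms(2,3) by (auto simp: Lower_def Upper_def)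
  have ae: "a \<sqsubseteq> e" and fb: "f \<sqsubseteq> b"
    using af fe eb assms(2,3) e(1) f(1) by (meson le_trans)+
  \<comment> \<open>Membership of e and f in R(a,b,x) amounts to four cone equations. The chains
    L(a) \<subseteq> L(x,f) \<subseteq> L(x,e) and U(b) \<subseteq> U(x,e) \<subseteq> U(x,f)
    collapse once their ends agree, so the lower equation for e and the upper one for f imply the
    other two.\<close>
  have "Lower P {a} \<subseteq> Lower P {x, f}" "Lower P {x, f} \<subseteq> Lower P {x, e}"
    using assms(2) x e(1) f(1) af fe by (auto simp: Lower_def intro: le_trans)
  moreover have "Upper P {b} \<subseteq> Upper P {x, e}" "Upper P {x, e} \<subseteq> Upper P {x, f}"
    using assms(3) x e(1) f(1) eb fe by (auto simp: Upper_def intro: le_trans)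
  ultimately have "e \<in> rel_complements P a b x \<and> f \<in> rel_complements P a b x \<longleftrightarrow>
      Lower P {x, e} = Lower P {a} \<and> Upper P {x, f} = Upper P {b}"
    using ae eb af fb e(1) f(1) by (auto simp: rel_complements_def at_least_at_most_def)
  also have "\<dots> \<longleftrightarrow> modular_triple P a y x \<and> modular_triple P x y b"
    using modular_triple_complement_below[OF assms(2,3) x(1) y x(2,3) UL assms(7)]
      modular_triple_complement_above[OF assms(2,3) x(1) y x(2,3) LU assms(8)] by simp
  finally show ?thesis
    using af fe eb by blast
qed

end
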